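(* Let $Q>0$ and let $(X,\mathsf d,\mu)$ be a locally compact, locally Ahlfors $Q$-regular metric measure space. For $x\in X$ and $r>0$ set $$\theta_r(x):=\frac{\mu(B_r(x))}{\omega_Q r^Q},\qquad \omega_Q:=\frac{\pi^{Q/2}}{\Gamma(Q/2+1)},\qquad |\mu_r|:=\frac{|1-\theta_r|}{r}\,\mu .$$ Assume that $|\mu_r|\rightharpoonup 0$ as $r\downarrow0$, i.e. $\int_X\varphi\,\frac{|1-\theta_r|}{r}\,d\mu\to0$ for every $\varphi\in C_c(X)$. Then a Lipschitz function $u:X\to\mathbb R$ admits a weak AMV Laplacian if and only if it admits a weak SAMV Laplacian, in which case the two are equal: $\mathbf{\Delta}^{\mathsf d}_\mu u=\tilde{\mathbf{\Delta}}^{\mathsf d}_\mu u$.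
   Context: A metric measure space $(X,\mathsf d,\mu)$ is a metric space $(X,\mathsf d)$ with a fully supported Borel measure $\mu$ such that $0<\mu(B_r(x))<+\infty$ for all $x\in X$, $r>0$, where $B_r(x)=\{y:\mathsf d(x,y)<r\}$. $\fint_A f\,d\mu:=\frac1{\mu(A)}\int_A f\,d\mu$. $C_c(X)$ is the set of compactly supported continuous functions. $(X,\mathsf d,\mu)$ is locally Ahlfors $Q$-regular if any $x_0\in X$ admits a neighborhood $V$ and constants $r_0,C>0$ (depending on $x_0$) such that $C^{-1}r^Q\le\mu(B_r(x))\le Cr^Q$ for all $x\in V$ and $r\in(0,r_0)$. For a continuous function $u$ and $r>0$ set $$\Delta^{\mathsf d}_{\mu,r}u(x):=\frac1{r^2}\fint_{B_r(x)}(u(y)-u(x))\,d\mu(y),\qquad \tilde\Delta^{\mathsf d}_{\mu,r}u(x):=\frac1{2r^2}\fint_{B_r(x)}(u(y)-u(x))\left(1+\frac{\mu(B_r(x))}{\mu(B_r(y))}\right)d\mu(y).$$ $u$ admits a weak AMV Laplacian if there is a (signed) Radon measure $\mathbf\Delta^{\mathsf d}_\mu u$, i.e. an element of the dual of $C_c(X)$, such that $(\Delta^{\mathsf d}_{\mu,r}u)\,\mu\rightharpoonup\mathbf\Delta^{\mathsf d}_\mu u$ as $r\downarrow0$, that is, $\int_X\varphi\,\Delta^{\mathsf d}_{\mu,r}u\,d\mu\to\int_X\varphi\,d\mathbf\Delta^{\mathsf d}_\mu u$ for all $\varphi\in C_c(X)$ (the integrals on the left being well defined for $r$ small, depending on $\varphi$).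 $u$ admits a weak SAMV Laplacian $\tilde{\mathbf\Delta}^{\mathsf d}_\mu u$ if the same holds with $\tilde\Delta^{\mathsf d}_{\mu,r}u$ in place of $\Delta^{\mathsf d}_{\mu,r}u$. *)

theory Defs
  imports "HOL-Analysis.Analysis"
begin

text \<open>
  The metric space is the whole type \<open>'a\<close>. Since every nonempty open set contains a ball, the
  positivity of the measure of balls says in particular that \<open>M\<close> has full support.
\<close>

definition metric_measure_space :: "'a::metric_space measure \<Rightarrow> bool" where
  "metric_measure_space M \<longleftrightarrow> sets M = sets borel \<and>
     (\<forall>x r. r > 0 \<longrightarrow> 0 < emeasure M (ball x r) \<and> emeasure M (ball x r) < \<infinity>)"

definition locally_Ahlfors_regular :: "real \<Rightarrow> 'a::metric_space measure \<Rightarrow> bool" where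
  "locally_Ahlfors_regular Q M \<longleftrightarrow>
     (\<forall>x0. \<exists>V r0 C. open V \<and> x0 \<in> V \<and> r0 > 0 \<and> C > 0 \<and>
        (\<forall>x\<in>V. \<forall>r. 0 < r \<and> r < r0 \<longrightarrow>
           inverse C * r powr Q \<le> measure M (ball x r) \<and>
           measure M (ball x r) \<le> C * r powr Q))"

definition average :: "'a measure \<Rightarrow> 'a set \<Rightarrow> ('a \<Rightarrow> real) \<Rightarrow> real" where
  "average M A f = 1 / measure M A * (LINT y:A|M. f y)"

definition AMV :: "'a::metric_space measure \<Rightarrow> real \<Rightarrow> ('a \<Rightarrow> real) \<Rightarrow> 'a \<Rightarrow> real" where
  "AMV M r u x = 1 / r\<^sup>2 * average M (ball x r) (\<lambda>y. u y - u x)"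

definition SAMV :: "'a::metric_space measure \<Rightarrow> real \<Rightarrow> ('a \<Rightarrow> real) \<Rightarrow> 'a \<Rightarrow> real" where
  "SAMV M r u x = 1 / (2 * r\<^sup>2) *
     average M (ball x r)
       (\<lambda>y. (u y - u x) * (1 + measure M (ball x r) / measure M (ball y r)))"

definition Cc :: "('a::topological_space \<Rightarrow> real) set" where
  "Cc = {\<phi>. continuous_on UNIV \<phi> \<and> compact (closure {x. \<phi> x \<noteq> 0})}"

text \<open>
  Signed Radon measures are the elements of the dual of \<open>Cc\<close>, for its inductive limit topology:
  the linear functionals that, for each compact \<open>K\<close>, are bounded in the supremum norm on the
  functions supported in \<open>K\<close>. They need not have finite total mass. Functionals are taken
  extensional on \<open>Cc\<close>, so that HOL equality is equality of functionals on \<open>Cc\<close>.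
\<close>

definition signed_Radon :: "(('a::topological_space \<Rightarrow> real) \<Rightarrow> real) set" where
  "signed_Radon = {\<Lambda> \<in> extensional Cc.
     (\<forall>\<phi>\<in>Cc. \<forall>\<psi>\<in>Cc. \<Lambda> (\<lambda>x. \<phi> x + \<psi> x) = \<Lambda> \<phi> + \<Lambda> \<psi>) \<and>
     (\<forall>c. \<forall>\<phi>\<in>Cc. \<Lambda> (\<lambda>x. c * \<phi> x) = c * \<Lambda> \<phi>) \<and>
     (\<forall>K. compact K \<longrightarrow>
        (\<exists>C. \<forall>\<phi>\<in>Cc. closure {x. \<phi> x \<noteq> 0} \<subseteq> K \<longrightarrow> \<bar>\<Lambda> \<phi>\<bar> \<le> C * (SUP x. \<bar>\<phi> x\<bar>)))}"

text \<open>
  Weak convergence of the measures \<open>f r\<cdot>M\<close> to \<open>\<Lambda>\<close> as \<open>r\<close> decreases to 0. The value of the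
  Lebesgue integral for non-integrable functions plays no role below: on a locally compact
  space, for given \<open>\<phi>\<close>, the integrands arising from a continuous \<open>u\<close> or from \<open>theta\<close> are
  integrable once \<open>r\<close> is small.
\<close>

definition weakly_tendsto ::
  "'a::topological_space measure \<Rightarrow> (real \<Rightarrow> 'a \<Rightarrow> real) \<Rightarrow> (('a \<Rightarrow> real) \<Rightarrow> real) \<Rightarrow> bool" where
  "weakly_tendsto M f \<Lambda> \<longleftrightarrow>
     (\<forall>\<phi>\<in>Cc. ((\<lambda>r. LINT x|M. \<phi> x * f r x) \<longlongrightarrow> \<Lambda> \<phi>) (at_right 0))"

definition has_weak_AMV_Laplacian ::
  "'a::metric_space measure \<Rightarrow> ('a \<Rightarrow> real) \<Rightarrow> (('a \<Rightarrow> real) \<Rightarrow> real) \<Rightarrow> bool" where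
  "has_weak_AMV_Laplacian M u \<Lambda> \<longleftrightarrow>
     \<Lambda> \<in> signed_Radon \<and> weakly_tendsto M (\<lambda>r. AMV M r u) \<Lambda>"

definition has_weak_SAMV_Laplacian ::
  "'a::metric_space measure \<Rightarrow> ('a \<Rightarrow> real) \<Rightarrow> (('a \<Rightarrow> real) \<Rightarrow> real) \<Rightarrow> bool" where
  "has_weak_SAMV_Laplacian M u \<Lambda> \<longleftrightarrow>
     \<Lambda> \<in> signed_Radon \<and> weakly_tendsto M (\<lambda>r. SAMV M r u) \<Lambda>"

text \<open>
  \<open>unit_ball_vol Q\<close> is, for every real \<open>Q\<close>, \<open>pi powr (Q / 2) / Gamma (Q / 2 + 1)\<close>.
\<close>

definition theta :: "real \<Rightarrow> 'a::metric_space measure \<Rightarrow> real \<Rightarrow> 'a \<Rightarrow> real" where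
  "theta Q M r x = measure M (ball x r) / (unit_ball_vol Q * r powr Q)"

end

theory Submission
  imports Defs
begin

text \<open>
  For \<open>\<phi>\<close> continuous with compact support, the difference of the integrals of
  \<open>\<phi> \<cdot> SAMV\<close> and \<open>\<phi> \<cdot> AMV\<close> is a double integral over pairs at distance less than \<open>r\<close> with kernel
  \<open>\<phi>(x) (u(y) - u(x)) (1/\<mu>(B\<^sub>r(y)) - 1/\<mu>(B\<^sub>r(x))) / (2 r\<^sup>2)\<close>. As \<open>u\<close> is Lipschitz and the balls have measure
  comparable to \<open>r\<^sup>Q\<close> near the support of \<open>\<phi>\<close>, the kernel is at most a constant times
  \<open>r\<^sup>-\<^sup>Q (\<bar>1 - \<theta>\<^sub>r(x)\<bar> + \<bar>1 - \<theta>\<^sub>r(y)\<bar>) / r\<close>. By Fubini, for a cutoff function \<open>\<psi>\<close> equal to 1 near the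
  support of \<open>\<phi>\<close>, the difference is at most a constant times the integral of \<open>\<psi> \<bar>1 - \<theta>\<^sub>r\<bar> / r\<close>, which
  tends to 0.
\<close>

section \<open>Test functions, cutoffs and uniform Ahlfors bounds on compact sets\<close>

lemma Cc_bounded:
  assumes "\<phi> \<in> Cc"
  obtains B where "B \<ge> 0" "\<And>x. \<bar>\<phi> x\<bar> \<le> B"
proof -
  let ?K = "closure {x. \<phi> x \<noteq> 0}"
  have "compact (\<phi> ` ?K)"
    using assms unfolding Cc_def
    by (auto intro!: compact_continuous_image intro: continuous_on_subset)
  then have "bounded (\<phi> ` ?K)" by (rule compact_imp_bounded)
  then obtain B where "\<forall>x\<in>\<phi> ` ?K. norm x \<le> B"
    unfolding bounded_iff by blast
  then have B: "\<bar>\<phi> x\<bar> \<le> B" if "x \<in> ?K" for x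
    using that by auto
  \<comment> \<open>If the support is empty, \<open>B\<close> may be negative, hence the absolute
    value.\<close>
  have "\<bar>\<phi> x\<bar> \<le> \<bar>B\<bar>" for x
  proof (cases "\<phi> x = 0")
    case False
    then have "x \<in> ?K" by (intro subsetD[OF closure_subset] CollectI)
    then show ?thesis using B[of x] by simp
  qed auto
  then show thesis using that[of "\<bar>B\<bar>"] by auto
qed

text \<open>Local compactness provides a compact neighbourhood \<open>L\<close> of \<open>K\<close>,
  and a function of the distance to \<open>K\<close> that vanishes before leaving \<open>L\<close>
  is a test function. A uniform \<open>\<delta>\<close> exists because a compact set stays at
  positive distance from the complement of an open set around it.\<close>

lemma compact_cutoff:
  fixes K :: "'a::metric_space set"
  assumes lc: "locally_compact_space (euclidean :: 'a topology)" and K: "compact K"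
  obtains \<psi> :: "'a \<Rightarrow> real" and \<delta> :: real
    where "\<psi> \<in> Cc" "\<And>x. 0 \<le> \<psi> x" "\<And>x. \<psi> x \<le> 1" "\<delta> > 0"
      "\<And>x y. x \<in> K \<Longrightarrow> dist x y < \<delta> \<Longrightarrow> \<psi> y = 1"
\<comment> \<open>By convention \<open>infdist\<close> to the empty set is 0, so the formula of the
  other case would give the constant 1, whose support need not be compact.\<close>
proof (cases "K = {}")
  case True
  have "(\<lambda>x::'a. 0::real) \<in> Cc" by (simp add: Cc_def)
  with True show thesis using that[of "\<lambda>_. 0" 1] by auto
next
  case False
  have "\<exists>U L. openin euclidean U \<and> compactin euclidean L \<and> closedin euclidean L \<and> K \<subseteq> U \<and> U \<subseteq> L"
    using lc K locally_compact_space_compact_closed_compact[of "euclidean :: 'a topology"] by simp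
  then obtain U L where U: "open U" "compact L" "K \<subseteq> U" "U \<subseteq> L"
    by auto
  obtain e where e: "e > 0" "(\<Union>x\<in>K. ball x e) \<subseteq> U"
    using compact_subset_open_imp_ball_epsilon_subset[OF K U(1,3)] by blast
  \<comment> \<open>Piecewise linear in the distance to \<open>K\<close>: 1 up to distance
    \<open>e / 3\<close>, 0 from distance \<open>2 * e / 3\<close> on.\<close>
  define \<psi> where "\<psi> y = min 1 (max 0 (2 - 3 / e * infdist y K))" for y
  have cont: "continuous_on UNIV \<psi>"
    unfolding \<psi>_def by (intro continuous_intros)
  have "{y. \<psi> y \<noteq> 0} \<subseteq> L"
  proof
    fix y assume "y \<in> {y. \<psi> y \<noteq> 0}"
    then have "infdist y K < e"
      using e(1) infdist_nonneg[of y K] by (auto simp: \<psi>_def field_simps min_def max_def split: if_splits)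
    then have "\<exists>x\<in>K. dist y x < e"
      using False by (auto simp: infdist_notempty cInf_less_iff)
    then show "y \<in> L" using e(2) U(4) by (force simp: dist_commute)
  qed
  then have "closure {y. \<psi> y \<noteq> 0} \<subseteq> L"
    by (simp add: U(2) closure_minimal compact_imp_closed)
  then have "compact (closure {y. \<psi> y \<noteq> 0})"
    using U(2) by (metis closed_closure compact_Int_closed inf.absorb_iff2)
  then have "\<psi> \<in> Cc" using cont by (simp add: Cc_def)
  moreover have "\<psi> y = 1" if "x \<in> K" "dist x y < e / 3" for x y
  proof -
    have "infdist y K \<le> e / 3"
      using infdist_le[OF that(1), of y] that(2) by (simp add: dist_commute)
    then show ?thesis using e(1) by (simp add: \<psi>_def field_simps min_def max_def)
  qed
  ultimately show thesis
    using that[of \<psi> "e / 3"] e(1) by (auto simp: \<psi>_def)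
qed

text \<open>Finitely many of the neighbourhoods of local regularity cover \<open>K\<close>; the
  smallest radius and the largest constant serve all of them, since enlarging the constant weakens
  both bounds.\<close>

lemma Ahlfors_uniform_on_compact:
  fixes M :: "'a::metric_space measure"
  assumes A: "locally_Ahlfors_regular Q M" and K: "compact K"
  obtains r0 C where "r0 > 0" "C > 0"
    "\<And>x r. x \<in> K \<Longrightarrow> 0 < r \<Longrightarrow> r < r0 \<Longrightarrow>
       inverse C * r powr Q \<le> measure M (ball x r) \<and> measure M (ball x r) \<le> C * r powr Q"
proof -
  obtain V \<rho> c where V: "\<And>z. open (V z)" "\<And>z. z \<in> V z" "\<And>z. \<rho> z > 0" "\<And>z. c z > 0"
    and reg: "\<And>z x r. x \<in> V z \<Longrightarrow> 0 < r \<Longrightarrow> r < \<rho> z \<Longrightarrow>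
      inverse (c z) * r powr Q \<le> measure M (ball x r) \<and> measure M (ball x r) \<le> c z * r powr Q"
    using A unfolding locally_Ahlfors_regular_def by metis
  have "K \<subseteq> (\<Union>z\<in>UNIV. V z)" using V(2) by auto
  then obtain Z where "Z \<subseteq> UNIV" and Z: "finite Z" "K \<subseteq> (\<Union>z\<in>Z. V z)"
    by (rule compactE_image[OF K V(1)])
  \<comment> \<open>The inserted 1 keeps \<open>Min\<close> and \<open>Max\<close> meaningful when
    \<open>Z\<close> is empty; otherwise it can only shrink \<open>r0\<close> and enlarge
    \<open>C\<close>.\<close>
  define r0 where "r0 = Min (insert 1 (\<rho> ` Z))"
  define C where "C = Max (insert 1 (c ` Z))"
  have r0: "r0 > 0" using Z(1) V(3) by (auto simp: r0_def)
  have C: "C > 0" using Z(1) by (auto simp: C_def Max_gr_iff)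
  have "inverse C * r powr Q \<le> measure M (ball x r) \<and> measure M (ball x r) \<le> C * r powr Q"
    if x: "x \<in> K" and r: "0 < r" "r < r0" for x r
  proof -
    obtain z where z: "z \<in> Z" "x \<in> V z" using x Z(2) by blast
    have "r0 \<le> \<rho> z" using z(1) Z(1) by (simp add: r0_def)
    then have "inverse (c z) * r powr Q \<le> measure M (ball x r)" "measure M (ball x r) \<le> c z * r powr Q"
      using reg[OF z(2) r(1)] r(2) by auto
    moreover have "c z \<le> C" using z(1) Z(1) by (simp add: C_def)
    then have "inverse C * r powr Q \<le> inverse (c z) * r powr Q" "c z * r powr Q \<le> C * r powr Q"
      using V(4)[of z] by (auto intro!: mult_right_mono le_imp_inverse_le)
    ultimately show ?thesis by linarith
  qed
  with r0 C show thesis using that by blast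
qed

section \<open>Finiteness and measurability of the measure of balls\<close>

locale mm_space =
  fixes M :: "'a::metric_space measure"
  assumes mms: "metric_measure_space M"
begin

lemma sets_M [measurable_cong]: "sets M = sets borel"
  using mms by (simp add: metric_measure_space_def)

lemma space_M [simp]: "space M = UNIV"
  using sets_eq_imp_space_eq[OF sets_M] by simp

lemma emeasure_ball_finite: "emeasure M (ball x r) < \<infinity>"
  using mms by (cases "r > 0") (auto simp: metric_measure_space_def ball_empty)

lemma measure_ball_pos: "r > 0 \<Longrightarrow> 0 < measure M (ball x r)"
  using mms emeasure_ball_finite[of x r]
  by (auto simp: metric_measure_space_def measure_def enn2real_positive_iff)

lemma emeasure_bounded_finite:
  assumes "bounded S" shows "emeasure M S < \<infinity>"
proof -
  \<comment> \<open>Here \<open>undefined\<close> is just an arbitrary base point of the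
    space.\<close>
  obtain r where "S \<subseteq> ball undefined r"
    using assms bounded_subset_ballD by blast
  then have "emeasure M S \<le> emeasure M (ball undefined r)"
    by (intro emeasure_mono) (auto simp: sets_M)
  then show ?thesis using emeasure_ball_finite[of undefined r] by (rule order_le_less_trans)
qed

text \<open>Balls of integer radius about a fixed point exhaust the space. Sigma-finiteness is what
  makes Fubini available on the square.\<close>

lemma sigma_finite: "sigma_finite_measure M"
proof (rule sigma_finite_measure.intro, intro exI conjI)
  show "countable (range (\<lambda>n::nat. ball (undefined::'a) (real n)))" by simp
  show "range (\<lambda>n::nat. ball (undefined::'a) (real n)) \<subseteq> sets M" by (auto simp: sets_M)
  show "\<Union> (range (\<lambda>n::nat. ball (undefined::'a) (real n))) = space M"
    by (auto simp: reals_Archimedean2)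
  show "\<forall>a\<in>range (\<lambda>n::nat. ball (undefined::'a) (real n)). emeasure M a \<noteq> \<infinity>"
    using emeasure_ball_finite by (auto simp: less_top)
qed

sublocale sigma_finite_measure M
  by (rule sigma_finite)

sublocale pair: pair_sigma_finite M M
  by unfold_locales

text \<open>By continuity from below, \<open>x \<mapsto> \<mu>(B\<^sub>r(x))\<close> is lower semicontinuous.\<close>

lemma measure_ball_measurable [measurable]: "(\<lambda>x. measure M (ball x r)) \<in> borel_measurable M"
  unfolding borel_measurable_iff_greater
proof
  fix a
  have "open {x. a < measure M (ball x r)}"
    unfolding open_dist
  proof (intro ballI, clarsimp)
    fix x assume a: "a < measure M (ball x r)"
    have eq: "(\<Union>n::nat. ball x (r - 1 / Suc n)) = ball x r"
    proof (intro equalityI subsetI)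
      fix y assume "y \<in> ball x r"
      then obtain n :: nat where "1 / Suc n < r - dist x y"
        using nat_approx_posE[of "r - dist x y"] by auto
      then show "y \<in> (\<Union>n::nat. ball x (r - 1 / Suc n))"
        by (auto intro!: exI[of _ n])
    qed (auto intro: order_less_le_trans)
    have "(\<lambda>n::nat. measure M (ball x (r - 1 / Suc n))) \<longlonglongrightarrow> measure M (\<Union>n::nat. ball x (r - 1 / Suc n))"
    proof (rule Lim_measure_incseq)
      show "incseq (\<lambda>n::nat. ball x (r - 1 / Suc n))"
        by (intro incseq_SucI subset_ball) (simp add: field_simps)
      show "emeasure M (\<Union>n::nat. ball x (r - 1 / Suc n)) \<noteq> \<infinity>"
        unfolding eq using emeasure_ball_finite[of x r] by (simp add: less_top)
    qed (auto simp: sets_M)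
    then obtain n :: nat where n: "a < measure M (ball x (r - 1 / Suc n))"
      using order_tendstoD(1)[of _ _ sequentially a] a eq
      by (metis (no_types, lifting) eventually_happens' sequentially_bot)
    \<comment> \<open>The slack \<open>1 / Suc n\<close> in the radius absorbs the displacement of
      the centre from \<open>x\<close> to \<open>y\<close>.\<close>
    have "a < measure M (ball y r)" if "dist y x < 1 / Suc n" for y
    proof -
      have "ball x (r - 1 / Suc n) \<subseteq> ball y r"
      proof
        fix z assume "z \<in> ball x (r - 1 / Suc n)"
        then show "z \<in> ball y r" using that dist_triangle[of y z x] by simp
      qed
      then have "measure M (ball x (r - 1 / Suc n)) \<le> measure M (ball y r)"
        using emeasure_ball_finite[of y r]
        by (intro measure_mono_fmeasurable) (auto simp: sets_M fmeasurable_def)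
      with n show ?thesis by linarith
    qed
    then show "\<exists>e>0. \<forall>y. dist y x < e \<longrightarrow> a < measure M (ball y r)"
      by (intro exI[of _ "1 / Suc n"]) auto
  qed
  then show "{w \<in> space M. a < measure M (ball w r)} \<in> sets M"
    by (simp add: sets_M)
qed

section \<open>Integration over pairs of nearby points\<close>

text \<open>The domain of the double integrals. Confining both coordinates to \<open>K\<close> puts
  it inside \<open>K \<times> K\<close> and keeps it invariant under swapping the
  coordinates.\<close>

definition near_diagonal :: "'a set \<Rightarrow> real \<Rightarrow> ('a \<times> 'a) set" where
  "near_diagonal K r = {(x, y). x \<in> K \<and> y \<in> K \<and> dist x y < r}"

text \<open>The space is not assumed to be second countable, so open subsets of the square need not be
  measurable for the product sigma-algebra; the separability of \<open>K\<close> is what is used here.\<close>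

lemma near_diagonal_sets [measurable]:
  assumes K: "compact K"
  shows "near_diagonal K r \<in> sets (M \<Otimes>\<^sub>M M)"
proof -
  have "\<exists>D. finite D \<and> K \<subseteq> (\<Union>x\<in>D. ball x (1 / Suc n))" for n :: nat
    using K unfolding compact_eq_totally_bounded by simp
  then obtain D where D: "\<And>n::nat. finite (D n)" "\<And>n::nat. K \<subseteq> (\<Union>x\<in>D n. ball x (1 / Suc n))"
    by metis
  \<comment> \<open>A countable union of measurable rectangles, centred at the points of finite
    \<open>1 / Suc n\<close>-nets of \<open>K\<close>. The second radius gives up
    \<open>1 / Suc n\<close> so that the triangle inequality through \<open>q\<close> yields
    \<open>dist x y < r\<close>.\<close>
  have eq: "near_diagonal K r =
    (\<Union>n. \<Union>q\<in>D n. (K \<inter> ball q (1 / Suc n)) \<times> (K \<inter> ball q (r - 1 / Suc n)))" (is "_ = ?R")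
  proof (intro equalityI subsetI)
    fix p assume "p \<in> near_diagonal K r"
    then obtain x y where p: "p = (x, y)" "x \<in> K" "y \<in> K" "dist x y < r"
      by (auto simp: near_diagonal_def)
    \<comment> \<open>Half of the gap, because \<open>1 / Suc n\<close> is spent twice: on the way
      from \<open>x\<close> to \<open>q\<close> and in the reduced second radius.\<close>
    then obtain n :: nat where n: "1 / Suc n < (r - dist x y) / 2"
      using nat_approx_posE[of "(r - dist x y) / 2"] by auto
    obtain q where q: "q \<in> D n" "dist q x < 1 / Suc n"
      using D(2)[of n] p(2) by auto
    have "dist q y < r - 1 / Suc n"
      using dist_triangle[of q y x] q(2) n by argo
    then show "p \<in> ?R" using p q by auto
  next
    fix p assume "p \<in> ?R"
    then obtain n q x y where p: "p = (x, y)" "x \<in> K" "y \<in> K"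
      "dist q x < 1 / Suc n" "dist q y < r - 1 / Suc n" by auto
    then show "p \<in> near_diagonal K r"
      using dist_triangle[of x y q] by (auto simp: near_diagonal_def dist_commute)
  qed
  have "K \<in> sets borel" using K by (simp add: borel_closed compact_imp_closed)
  then have "K \<inter> ball q s \<in> sets M" for q s by (auto simp: sets_M)
  then show ?thesis unfolding eq
    using D(1) by (intro sets.countable_UN sets.finite_UN image_subsetI) auto
qed

lemma near_diagonal_finite:
  assumes K: "compact K"
  shows "emeasure (M \<Otimes>\<^sub>M M) (near_diagonal K r) < \<infinity>"
proof -
  have K': "K \<in> sets M" using K by (simp add: borel_closed compact_imp_closed sets_M)
  have "emeasure (M \<Otimes>\<^sub>M M) (near_diagonal K r) \<le> emeasure (M \<Otimes>\<^sub>M M) (K \<times> K)"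
    using K' by (intro emeasure_mono) (auto simp: near_diagonal_def)
  also have "\<dots> = emeasure M K * emeasure M K"
    using K' by (rule emeasure_pair_measure_Times[OF K'])
  also have "\<dots> < \<infinity>"
    using emeasure_bounded_finite[OF compact_imp_bounded[OF K]] by (simp add: ennreal_mult_less_top)
  finally show ?thesis .
qed

text \<open>A bounded measurable function on a set of finite measure. The bound is asked for on the
  near-diagonal alone, where both the increments of \<open>u\<close> and the reciprocals of ball
  measures are under control.\<close>

lemma near_diagonal_integrable:
  fixes f :: "'a \<times> 'a \<Rightarrow> real"
  assumes "compact K" "f \<in> borel_measurable (M \<Otimes>\<^sub>M M)"
    "\<And>x y. (x, y) \<in> near_diagonal K r \<Longrightarrow> \<bar>f (x, y)\<bar> \<le> B"
  shows "integrable (M \<Otimes>\<^sub>M M) (\<lambda>p. indicator (near_diagonal K r) p * f p)"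
proof -
  have "AE p in M \<Otimes>\<^sub>M M. p \<in> near_diagonal K r \<longrightarrow> norm (f p) \<le> B"
    using assms(3) by auto
  from integrableI_bounded_set_indicator[OF near_diagonal_sets[OF assms(1)] assms(2)
      near_diagonal_finite[OF assms(1)] this]
  show ?thesis by simp
qed

text \<open>By Fubini, the variable on which \<open>G\<close> does not depend contributes the
  measure of a section, and the section at \<open>x\<close> lies in \<open>ball x r\<close>. The
  second inequality reduces to the first by the symmetry of
  \<open>near_diagonal K r\<close>.\<close>

lemma near_diagonal_integral_le:
  fixes G :: "'a \<Rightarrow> real"
  assumes K: "compact K" and G: "G \<in> borel_measurable M"
    and bd: "\<And>x. 0 \<le> G x" "\<And>x. G x \<le> B" "\<And>x. x \<notin> K \<Longrightarrow> G x = 0"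
    and m: "\<And>x. x \<in> K \<Longrightarrow> measure M (ball x r) \<le> c"
  shows "(LINT p|(M \<Otimes>\<^sub>M M). indicator (near_diagonal K r) p * G (fst p)) \<le> c * (LINT x|M. G x)"
    and "(LINT p|(M \<Otimes>\<^sub>M M). indicator (near_diagonal K r) p * G (snd p)) \<le> c * (LINT x|M. G x)"
proof -
  note [measurable] = G
  have K': "K \<in> sets M" using K by (simp add: borel_closed compact_imp_closed sets_M)
  have sec: "(LINT y|M. indicator (near_diagonal K r) (x, y) * G x) \<le> c * G x" for x
  proof (cases "x \<in> K")
    case True
    have "(LINT y|M. indicator (near_diagonal K r) (x, y) * G x)
        = (LINT y|M. indicator (K \<inter> ball x r) y * G x)"
      using True by (intro Bochner_Integration.integral_cong) (auto simp: near_diagonal_def indicator_def)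
    also have "\<dots> = measure M (K \<inter> ball x r) * G x" by simp
    also have "measure M (K \<inter> ball x r) \<le> measure M (ball x r)"
      using emeasure_ball_finite[of x r] K'
      by (intro measure_mono_fmeasurable) (auto simp: sets_M fmeasurable_def)
    also have "\<dots> \<le> c" using m True .
    finally show ?thesis using bd(1) by (simp add: mult_right_mono)
  next
    case False
    then show ?thesis by (simp add: bd(3))
  qed
  have Gint: "integrable M G"
  proof -
    have "integrable M (\<lambda>x. indicator K x *\<^sub>R G x)"
      using bd(1,2) K' emeasure_bounded_finite[OF compact_imp_bounded[OF K]]
      by (intro integrableI_bounded_set_indicator[where B=B]) auto
    also have "(\<lambda>x. indicator K x *\<^sub>R G x) = G"
      by (rule ext) (use bd(3) in \<open>auto simp: indicator_def\<close>)
    finally show ?thesis .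
  qed
  have int1: "integrable (M \<Otimes>\<^sub>M M) (\<lambda>p. indicator (near_diagonal K r) p * G (fst p))"
    using bd(1,2) by (intro near_diagonal_integrable[OF K, where B=B]) auto
  have int2: "integrable (M \<Otimes>\<^sub>M M) (\<lambda>p. indicator (near_diagonal K r) p * G (snd p))"
    using bd(1,2) by (intro near_diagonal_integrable[OF K, where B=B]) auto
  have "(LINT p|(M \<Otimes>\<^sub>M M). indicator (near_diagonal K r) p * G (fst p))
      = (LINT x|M. LINT y|M. indicator (near_diagonal K r) (x, y) * G x)"
    using pair.integral_fst'[OF int1] by simp
  also have "\<dots> \<le> (LINT x|M. c * G x)"
    using pair.integrable_fst'[OF int1] Gint sec by (intro integral_mono) auto
  finally show fst_le: "(LINT p|(M \<Otimes>\<^sub>M M). indicator (near_diagonal K r) p * G (fst p)) \<le> c * (LINT x|M. G x)"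
    by simp
  have "(LINT p|(M \<Otimes>\<^sub>M M). indicator (near_diagonal K r) p * G (snd p))
      = (LINT p|(M \<Otimes>\<^sub>M M). indicator (near_diagonal K r) p * G (fst p))"
    using pair.integral_product_swap[of "\<lambda>p. indicator (near_diagonal K r) p * G (snd p)"] int2
    by (simp add: case_prod_beta' near_diagonal_def indicator_def dist_commute conj_ac)
  with fst_le
  show "(LINT p|(M \<Otimes>\<^sub>M M). indicator (near_diagonal K r) p * G (snd p)) \<le> c * (LINT x|M. G x)"
    by simp
qed

section \<open>The two Laplacians as integrals against kernels\<close>

text \<open>Where \<open>\<phi>\<close> is nonzero the whole ball lies in \<open>K\<close>, so the
  section of \<open>near_diagonal K r\<close> is exactly \<open>ball x r\<close> and the truncation
  loses nothing.\<close>

lemma AMV_as_kernel: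
  assumes "\<phi> x \<noteq> 0 \<Longrightarrow> x \<in> K \<and> ball x r \<subseteq> K"
  shows "\<phi> x * AMV M r u x = (LINT y|M. indicator (near_diagonal K r) (x, y) *
    (\<phi> x * (u y - u x) * (1 / measure M (ball x r)) / r\<^sup>2))"
proof (cases "\<phi> x = 0")
  case False
  have "indicator (near_diagonal K r) (x, y) * (\<phi> x * (u y - u x) * (1 / measure M (ball x r)) / r\<^sup>2)
      = (\<phi> x / (r\<^sup>2 * measure M (ball x r))) * (indicator (ball x r) y * (u y - u x))" for y
    using assms False by (auto simp: near_diagonal_def indicator_def)
  then show ?thesis
    by (simp add: AMV_def average_def set_lebesgue_integral_def)
qed simp

text \<open>Dividing the symmetrizing weight by \<open>measure M (ball x r)\<close> turns it into a
  sum of two reciprocals. The kernel is thus that of \<open>AMV\<close> with the reciprocal at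
  \<open>x\<close> replaced by the mean of those at \<open>x\<close> and \<open>y\<close>;
  positivity of \<open>r\<close> makes the measures nonzero for the cancellation.\<close>

lemma SAMV_as_kernel:
  assumes "\<phi> x \<noteq> 0 \<Longrightarrow> x \<in> K \<and> ball x r \<subseteq> K" and "r > 0"
  shows "\<phi> x * SAMV M r u x = (LINT y|M. indicator (near_diagonal K r) (x, y) *
    (\<phi> x * (u y - u x) * ((1 / measure M (ball x r) + 1 / measure M (ball y r)) / 2) / r\<^sup>2))"
proof (cases "\<phi> x = 0")
  case False
  have "indicator (near_diagonal K r) (x, y) *
        (\<phi> x * (u y - u x) * ((1 / measure M (ball x r) + 1 / measure M (ball y r)) / 2) / r\<^sup>2)
      = (\<phi> x / (2 * r\<^sup>2 * measure M (ball x r))) *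
        (indicator (ball x r) y * ((u y - u x) * (1 + measure M (ball x r) / measure M (ball y r))))" for y
    using assms False measure_ball_pos[OF \<open>r > 0\<close>, of x] measure_ball_pos[OF \<open>r > 0\<close>, of y]
    by (auto simp: near_diagonal_def indicator_def field_simps)
  then show ?thesis
    by (simp add: SAMV_def average_def set_lebesgue_integral_def)
qed simp

section \<open>Comparison of the two Laplacians at a fixed radius\<close>

text \<open>In the constant, \<open>B\<close> bounds \<open>\<phi>\<close>, \<open>L\<close> comes
  from the increments of \<open>u\<close>, and \<open>unit_ball_vol Q\<close> from expressing ball
  measures through \<open>theta\<close>. Two of the three factors \<open>C\<close> bound the
  reciprocals at \<open>x\<close> and \<open>y\<close>, the third bounds a section in
  Fubini.\<close>

lemma SAMV_AMV_estimate:
  fixes u \<phi> \<psi> :: "'a \<Rightarrow> real"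
  assumes Q: "Q > 0" and r: "r > 0" and C: "C > 0" and B: "B \<ge> 0"
    and L: "L-lipschitz_on UNIV u" and K: "compact K"
    and \<phi>: "\<phi> \<in> borel_measurable borel" "\<And>x. \<bar>\<phi> x\<bar> \<le> B"
    and \<psi>: "\<psi> \<in> borel_measurable borel" "\<And>x. 0 \<le> \<psi> x" "\<And>x. \<psi> x \<le> 1" "\<And>x. \<psi> x \<noteq> 0 \<Longrightarrow> x \<in> K"
    and \<psi>1: "\<And>x y. \<phi> x \<noteq> 0 \<Longrightarrow> dist x y < r \<Longrightarrow> \<psi> y = 1"
    and reg: "\<And>x. x \<in> K \<Longrightarrow> inverse C * r powr Q \<le> measure M (ball x r)"
      "\<And>x. x \<in> K \<Longrightarrow> measure M (ball x r) \<le> C * r powr Q"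
  shows "\<bar>(LINT x|M. \<phi> x * SAMV M r u x) - (LINT x|M. \<phi> x * AMV M r u x)\<bar>
    \<le> B * L * unit_ball_vol Q * C ^ 3 * (LINT x|M. \<psi> x * (\<bar>1 - theta Q M r x\<bar> / r))"
proof -
  define m where "m x = measure M (ball x r)" for x
  define R where "R = r powr Q"
  define \<omega> where "\<omega> = unit_ball_vol Q"
  define S where "S = near_diagonal K r"
  \<comment> \<open>The weight \<open>w\<close> is left open so that integrability is proved once
    for both kernels: \<open>wa\<close> gives \<open>AMV\<close> and \<open>ws\<close> gives
    \<open>SAMV\<close>.\<close>
  define k where "k w p = \<phi> (fst p) * (u (snd p) - u (fst p)) * w p / r\<^sup>2" for w and p :: "'a \<times> 'a"
  define wa where "wa p = 1 / m (fst p)" for p :: "'a \<times> 'a"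
  define ws where "ws p = (1 / m (fst p) + 1 / m (snd p)) / 2" for p :: "'a \<times> 'a"
  define G where "G x = \<psi> x * \<bar>1 - theta Q M r x\<bar>" for x
  have R: "R > 0" using r by (simp add: R_def)
  have \<omega>: "\<omega> > 0" using Q by (simp add: \<omega>_def)
  have L0: "L \<ge> 0" using L by (simp add: lipschitz_on_def)
  have m_theta: "m x = \<omega> * R * theta Q M r x" for x
    using R \<omega> by (simp add: m_def theta_def R_def \<omega>_def)
  have m_pos: "m x > 0" for x using measure_ball_pos[OF r] by (simp add: m_def)
  have inv_m: "1 / m x \<le> C / R" if "x \<in> K" for x
    using reg(1)[OF that] m_pos[of x] R C by (simp add: m_def[symmetric] R_def[symmetric] field_simps)
  have u_lip: "\<bar>u y - u x\<bar> \<le> L * r" if "dist x y < r" for x y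
  proof -
    have "\<bar>u y - u x\<bar> \<le> L * dist y x"
      using lipschitz_onD[OF L, of y x] by (simp add: dist_real_def)
    also have "\<dots> \<le> L * r" using that L0 by (intro mult_left_mono) (auto simp: dist_commute)
    finally show ?thesis .
  qed
  have [measurable]: "u \<in> borel_measurable borel"
    using lipschitz_on_continuous_on[OF L] by (rule borel_measurable_continuous_onI)
  note [measurable] = \<phi>(1) \<psi>(1)
  have [measurable]: "m \<in> borel_measurable M" unfolding m_def by measurable
  have [measurable]: "G \<in> borel_measurable M" unfolding G_def theta_def by measurable
  have [measurable]: "wa \<in> borel_measurable (M \<Otimes>\<^sub>M M)" "ws \<in> borel_measurable (M \<Otimes>\<^sub>M M)"
    unfolding wa_def ws_def by measurable
  have k_int: "integrable (M \<Otimes>\<^sub>M M) (\<lambda>p. indicator S p * k w p)"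
    if [measurable]: "w \<in> borel_measurable (M \<Otimes>\<^sub>M M)"
      and w: "\<And>x y. x \<in> K \<Longrightarrow> y \<in> K \<Longrightarrow> \<bar>w (x, y)\<bar> \<le> C / R" for w
    unfolding S_def
  proof (rule near_diagonal_integrable[OF K])
    show "k w \<in> borel_measurable (M \<Otimes>\<^sub>M M)" unfolding k_def by measurable
    show "\<bar>k w (x, y)\<bar> \<le> B * (L * r) * (C / R) / r\<^sup>2" if "(x, y) \<in> near_diagonal K r" for x y
    proof -
      have xy: "x \<in> K" "y \<in> K" "dist x y < r" using that by (auto simp: near_diagonal_def)
      have "\<bar>k w (x, y)\<bar> = \<bar>\<phi> x\<bar> * \<bar>u y - u x\<bar> * \<bar>w (x, y)\<bar> / r\<^sup>2"
        by (simp add: k_def abs_mult)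
      also have "\<dots> \<le> B * (L * r) * (C / R) / r\<^sup>2"
        using \<phi>(2) u_lip[OF xy(3)] w[OF xy(1,2)] r B L0
        by (intro divide_right_mono mult_mono) auto
      finally show ?thesis .
    qed
  qed
  have wa_int: "integrable (M \<Otimes>\<^sub>M M) (\<lambda>p. indicator S p * k wa p)"
  proof (rule k_int)
    show "\<bar>wa (x, y)\<bar> \<le> C / R" if "x \<in> K" "y \<in> K" for x y
      using inv_m[OF that(1)] m_pos[of x] by (simp add: wa_def)
  qed measurable
  have ws_int: "integrable (M \<Otimes>\<^sub>M M) (\<lambda>p. indicator S p * k ws p)"
  proof (rule k_int)
    show "\<bar>ws (x, y)\<bar> \<le> C / R" if "x \<in> K" "y \<in> K" for x y
    proof -
      have "0 < a \<Longrightarrow> 0 < b \<Longrightarrow> a \<le> t \<Longrightarrow> b \<le> t \<Longrightarrow> \<bar>(a + b) / 2\<bar> \<le> t" for a b t :: real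
        by (simp add: abs_if)
      from this[OF _ _ inv_m[OF that(1)] inv_m[OF that(2)]] show ?thesis
        using m_pos by (simp add: ws_def)
    qed
  qed measurable
  \<comment> \<open>On \<open>ball x r\<close> the cutoff equals 1, and it vanishes outside
    \<open>K\<close>.\<close>
  have sub: "x \<in> K \<and> ball x r \<subseteq> K" if "\<phi> x \<noteq> 0" for x
    using \<psi>1[OF that] \<psi>(4) r by fastforce
  have AMV_eq: "(LINT x|M. \<phi> x * AMV M r u x) = (LINT p|(M \<Otimes>\<^sub>M M). indicator S p * k wa p)"
    unfolding pair.integral_fst'[OF wa_int, symmetric]
    using AMV_as_kernel[of \<phi> _ K r u] sub
    by (intro Bochner_Integration.integral_cong) (auto simp: k_def wa_def S_def m_def)
  have SAMV_eq: "(LINT x|M. \<phi> x * SAMV M r u x) = (LINT p|(M \<Otimes>\<^sub>M M). indicator S p * k ws p)"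
    unfolding pair.integral_fst'[OF ws_int, symmetric]
    using SAMV_as_kernel[of \<phi> _ K r u] sub r
    by (intro Bochner_Integration.integral_cong) (auto simp: k_def ws_def S_def m_def)
  \<comment> \<open>Bounds \<open>\<bar>ws p - wa p\<bar>\<close> relative to
    \<open>G x + G y\<close>: \<open>\<omega> * R\<close> converts \<open>theta\<close> into ball
    measures, each \<open>C / R\<close> bounds a reciprocal, and 2 comes from the mean.\<close>
  define W where "W = \<omega> * R * (C / R * (C / R)) / 2"
  define c where "c = B * (L * r) * W / r\<^sup>2"
  have c: "c \<ge> 0" using B L0 r \<omega> R C by (simp add: c_def W_def)
  have theta_le: "theta Q M r x \<le> C / \<omega>" if "x \<in> K" for x
    using reg(2)[OF that] R \<omega> m_theta[of x] by (simp add: m_def[symmetric] R_def[symmetric] field_simps)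
  have theta_pos: "theta Q M r x > 0" for x
    using m_pos[of x] R \<omega> by (simp add: m_def theta_def \<omega>_def R_def)
  have G0: "0 \<le> G x" for x using \<psi>(2) by (simp add: G_def)
  \<comment> \<open>This bound serves integrability; its value does not enter the final
    constant.\<close>
  have GB: "G x \<le> 1 + C / \<omega>" for x
  proof (cases "x \<in> K")
    case True
    have "G x \<le> 1 * \<bar>1 - theta Q M r x\<bar>" unfolding G_def using \<psi>(3) by (intro mult_right_mono) auto
    also have "1 * \<bar>1 - theta Q M r x\<bar> \<le> 1 + C / \<omega>"
      using theta_le[OF True] theta_pos[of x] by (simp add: abs_le_iff)
    finally show ?thesis .
  next
    case False
    then have "G x = 0" using \<psi>(4) by (auto simp: G_def)
    then show ?thesis using C \<omega> by simp
  qed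
  have GK: "G x = 0" if "x \<notin> K" for x using \<psi>(4) that by (auto simp: G_def)
  have pt: "\<bar>indicator S p * k ws p - indicator S p * k wa p\<bar>
      \<le> c * (indicator S p * G (fst p) + indicator S p * G (snd p))" for p
  proof (cases "p \<in> S \<and> \<phi> (fst p) \<noteq> 0")
    case True
    obtain x y where p: "p = (x, y)" by (cases p)
    have xy: "x \<in> K" "y \<in> K" "dist x y < r" "\<phi> x \<noteq> 0"
      using True by (auto simp: p S_def near_diagonal_def)
    have G_eq: "G x = \<bar>1 - theta Q M r x\<bar>" "G y = \<bar>1 - theta Q M r y\<bar>"
      using \<psi>1[OF xy(4), of x] \<psi>1[OF xy(4,3)] r by (auto simp: G_def)
    have "\<bar>1 / m y - 1 / m x\<bar> = \<bar>m x - m y\<bar> * (1 / m x * (1 / m y))"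
      using m_pos[of x] m_pos[of y] by (simp add: field_simps abs_divide abs_mult)
    also have "\<dots> \<le> (\<omega> * R * (G x + G y)) * (C / R * (C / R))"
    proof (intro mult_mono)
      have "\<bar>m x - m y\<bar> = \<omega> * R * \<bar>theta Q M r x - theta Q M r y\<bar>"
        using \<omega> R by (simp add: m_theta right_diff_distrib[symmetric] abs_mult)
      \<comment> \<open>Both values of \<open>theta\<close> are compared with 1.\<close>
      also have "\<dots> \<le> \<omega> * R * (G x + G y)"
        using \<omega> R by (intro mult_left_mono) (auto simp: G_eq)
      finally show "\<bar>m x - m y\<bar> \<le> \<omega> * R * (G x + G y)" .
    qed (use inv_m xy m_pos[of x] m_pos[of y] \<omega> R C G0 in \<open>auto intro!: mult_nonneg_nonneg add_nonneg_nonneg\<close>)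
    finally have inv_diff: "\<bar>1 / m y - 1 / m x\<bar> \<le> (\<omega> * R * (G x + G y)) * (C / R * (C / R))" .
    \<comment> \<open>The mean of two numbers differs from the first by half their
      difference.\<close>
    have "ws p - wa p = (1 / m y - 1 / m x) / 2"
      unfolding p ws_def wa_def fst_conv snd_conv by argo
    then have "\<bar>ws p - wa p\<bar> = \<bar>1 / m y - 1 / m x\<bar> / 2"
      by (simp only: abs_divide abs_numeral)
    also have "\<dots> \<le> (\<omega> * R * (G x + G y)) * (C / R * (C / R)) / 2"
      using inv_diff by (rule divide_right_mono) simp
    also have "\<dots> = W * (G x + G y)"
      by (simp only: W_def times_divide_eq_left times_divide_eq_right mult_ac)
    finally have w: "\<bar>ws p - wa p\<bar> \<le> W * (G x + G y)" .
    have "k ws p - k wa p = \<phi> x * (u y - u x) * (ws p - wa p) / r\<^sup>2"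
      by (simp only: k_def p fst_conv snd_conv right_diff_distrib diff_divide_distrib)
    then have "\<bar>indicator S p * k ws p - indicator S p * k wa p\<bar> = \<bar>\<phi> x\<bar> * \<bar>u y - u x\<bar> * \<bar>ws p - wa p\<bar> / r\<^sup>2"
      using True by (simp add: abs_mult)
    also have "\<dots> \<le> B * (L * r) * (W * (G x + G y)) / r\<^sup>2"
      using \<phi>(2) u_lip[OF xy(3)] w B L0 r
      by (intro divide_right_mono mult_mono) auto
    also have "\<dots> = c * (G x + G y)"
      by (simp only: c_def times_divide_eq_left mult.assoc)
    finally show ?thesis using True by (simp add: p)
  next
    case False
    then have eq0: "indicator S p * k ws p - indicator S p * k wa p = 0"
      by (auto simp: k_def)
    show ?thesis unfolding eq0 using c G0 by simp
  qed
  have G_int: "integrable (M \<Otimes>\<^sub>M M) (\<lambda>p. indicator S p * G (fst p))"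
    "integrable (M \<Otimes>\<^sub>M M) (\<lambda>p. indicator S p * G (snd p))"
    unfolding S_def using G0 GB by (auto intro!: near_diagonal_integrable[OF K, where B="1 + C / \<omega>"])
  have "\<bar>(LINT x|M. \<phi> x * SAMV M r u x) - (LINT x|M. \<phi> x * AMV M r u x)\<bar>
      = \<bar>LINT p|(M \<Otimes>\<^sub>M M). indicator S p * k ws p - indicator S p * k wa p\<bar>"
    unfolding AMV_eq SAMV_eq using ws_int wa_int by simp
  also have "\<dots> \<le> (LINT p|(M \<Otimes>\<^sub>M M). \<bar>indicator S p * k ws p - indicator S p * k wa p\<bar>)"
    by (rule integral_abs_bound)
  also have "\<dots> \<le> (LINT p|(M \<Otimes>\<^sub>M M). c * (indicator S p * G (fst p) + indicator S p * G (snd p)))"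
    using ws_int wa_int G_int pt by (intro integral_mono) auto
  also have "\<dots> = c * ((LINT p|(M \<Otimes>\<^sub>M M). indicator S p * G (fst p)) + (LINT p|(M \<Otimes>\<^sub>M M). indicator S p * G (snd p)))"
    using G_int by simp
  also have "\<dots> \<le> c * (C * R * (LINT x|M. G x) + C * R * (LINT x|M. G x))"
    unfolding S_def using c reg(2) G0 GB GK
    by (intro mult_left_mono add_mono near_diagonal_integral_le[OF K, where B="1 + C / \<omega>"]) (auto simp: R_def)
  \<comment> \<open>The factor 1/2 in \<open>W\<close> absorbs the two equal integrals, the powers
    of \<open>R\<close> cancel, and the Lipschitz bound \<open>L * r\<close> leaves one of the two
    factors \<open>1 / r\<close>.\<close>
  also have "\<dots> = B * L * \<omega> * C ^ 3 * ((LINT x|M. G x) / r)"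
    using R r by (simp add: c_def W_def field_simps power2_eq_square power3_eq_cube)
  also have "(LINT x|M. G x) / r = (LINT x|M. \<psi> x * (\<bar>1 - theta Q M r x\<bar> / r))"
    by (simp add: G_def)
  finally show ?thesis by (simp add: \<omega>_def)
qed

section \<open>Passage to the limit\<close>

text \<open>The cutoff \<open>\<psi>\<close> is itself a test function, so the hypothesis on
  \<open>theta\<close> applies to it. It is chosen from \<open>\<phi>\<close> alone, and the
  constants from \<open>\<psi>\<close>, all independently of \<open>r\<close>.\<close>

lemma SAMV_AMV_tendsto_0:
  assumes Q: "Q > 0" and lc: "locally_compact_space (euclidean :: 'a topology)"
    and A: "locally_Ahlfors_regular Q M"
    and \<theta>: "weakly_tendsto M (\<lambda>r x. \<bar>1 - theta Q M r x\<bar> / r) (\<lambda>\<phi>. 0)"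
    and L: "L-lipschitz_on UNIV u" and \<phi>: "\<phi> \<in> Cc"
  shows "((\<lambda>r. (LINT x|M. \<phi> x * SAMV M r u x) - (LINT x|M. \<phi> x * AMV M r u x)) \<longlongrightarrow> 0) (at_right 0)"
proof -
  obtain B where B: "B \<ge> 0" "\<And>x. \<bar>\<phi> x\<bar> \<le> B" using Cc_bounded[OF \<phi>] by blast
  have "compact (closure {x. \<phi> x \<noteq> 0})" using \<phi> by (simp add: Cc_def)
  from compact_cutoff[OF lc this] obtain \<psi> \<delta> where
    \<psi>: "\<psi> \<in> Cc" "\<And>x. 0 \<le> \<psi> x" "\<And>x. \<psi> x \<le> 1" and \<delta>: "\<delta> > 0"
    and \<psi>1: "\<And>x y. x \<in> closure {x. \<phi> x \<noteq> 0} \<Longrightarrow> dist x y < \<delta> \<Longrightarrow> \<psi> y = 1" by blast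
  \<comment> \<open>The support of \<open>\<psi>\<close> rather than that of \<open>\<phi>\<close>:
    the estimate also needs regularity of balls centred at points \<open>y\<close> near the support
    of \<open>\<phi>\<close>.\<close>
  define K where "K = closure {x. \<psi> x \<noteq> 0}"
  have K: "compact K" using \<psi>(1) by (simp add: Cc_def K_def)
  obtain r0 C where r0: "r0 > 0" "C > 0"
    and reg: "\<And>x r. x \<in> K \<Longrightarrow> 0 < r \<Longrightarrow> r < r0 \<Longrightarrow>
       inverse C * r powr Q \<le> measure M (ball x r) \<and> measure M (ball x r) \<le> C * r powr Q"
    using Ahlfors_uniform_on_compact[OF A K] by blast
  have borel: "\<phi> \<in> borel_measurable borel" "\<psi> \<in> borel_measurable borel"
    using \<phi> \<psi>(1) by (auto simp: Cc_def intro: borel_measurable_continuous_onI)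
  have est: "\<bar>(LINT x|M. \<phi> x * SAMV M r u x) - (LINT x|M. \<phi> x * AMV M r u x)\<bar>
    \<le> B * L * unit_ball_vol Q * C ^ 3 * (LINT x|M. \<psi> x * (\<bar>1 - theta Q M r x\<bar> / r))"
    if r: "0 < r" "r < min r0 \<delta>" for r
  proof (rule SAMV_AMV_estimate[OF Q r(1) r0(2) B(1) L K borel(1) B(2) borel(2) \<psi>(2,3)])
    show "x \<in> K" if "\<psi> x \<noteq> 0" for x
      unfolding K_def using that by (intro subsetD[OF closure_subset] CollectI)
    show "\<psi> y = 1" if "\<phi> x \<noteq> 0" "dist x y < r" for x y
    proof (rule \<psi>1)
      show "x \<in> closure {x. \<phi> x \<noteq> 0}"
        using that(1) by (intro subsetD[OF closure_subset] CollectI)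
      show "dist x y < \<delta>" using that(2) r(2) by simp
    qed
    show "inverse C * r powr Q \<le> measure M (ball x r)" "measure M (ball x r) \<le> C * r powr Q"
      if "x \<in> K" for x
      using reg[OF that r(1)] r(2) by simp_all
  qed
  have ev: "\<forall>\<^sub>F r in at_right 0. norm ((LINT x|M. \<phi> x * SAMV M r u x) - (LINT x|M. \<phi> x * AMV M r u x))
    \<le> B * L * unit_ball_vol Q * C ^ 3 * (LINT x|M. \<psi> x * (\<bar>1 - theta Q M r x\<bar> / r))"
  proof (rule eventually_mono)
    show "\<forall>\<^sub>F r in at_right 0. r \<in> {0<..<min r0 \<delta>}"
      using r0(1) \<delta> by (intro eventually_at_right_real) simp
    show "norm ((LINT x|M. \<phi> x * SAMV M r u x) - (LINT x|M. \<phi> x * AMV M r u x))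
      \<le> B * L * unit_ball_vol Q * C ^ 3 * (LINT x|M. \<psi> x * (\<bar>1 - theta Q M r x\<bar> / r))"
      if "r \<in> {0<..<min r0 \<delta>}" for r
      using est[of r] that unfolding real_norm_def greaterThanLessThan_iff by blast
  qed
  have "((\<lambda>r. LINT x|M. \<psi> x * (\<bar>1 - theta Q M r x\<bar> / r)) \<longlongrightarrow> 0) (at_right 0)"
    using \<theta> \<psi>(1) by (simp add: weakly_tendsto_def)
  from Lim_null_comparison[OF ev tendsto_mult_right_zero[OF this]] show ?thesis .
qed

end

theorem proposition4p8:
  fixes M :: "'a::metric_space measure" and Q :: real and u :: "'a \<Rightarrow> real"
  assumes "Q > 0"
    and "metric_measure_space M"
    and "locally_compact_space (euclidean :: 'a topology)"
    and "locally_Ahlfors_regular Q M"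
    and "weakly_tendsto M (\<lambda>r x. \<bar>1 - theta Q M r x\<bar> / r) (\<lambda>\<phi>. 0)"
    and "\<exists>L. L-lipschitz_on UNIV u"
  shows "((\<exists>\<Lambda>. has_weak_AMV_Laplacian M u \<Lambda>) \<longleftrightarrow> (\<exists>\<Lambda>. has_weak_SAMV_Laplacian M u \<Lambda>)) \<and>
         (\<forall>\<Lambda> \<Lambda>'. has_weak_AMV_Laplacian M u \<Lambda> \<longrightarrow> has_weak_SAMV_Laplacian M u \<Lambda>' \<longrightarrow> \<Lambda> = \<Lambda>')"
proof -
  interpret mm_space M using assms(2) by unfold_locales
  obtain L where "L-lipschitz_on UNIV u" using assms(6) by blast
  note diff = SAMV_AMV_tendsto_0[OF assms(1,3-5) this]
  \<comment> \<open>Since \<open>signed_Radon\<close> does not refer to \<open>u\<close>, this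
    equivalence for each \<open>\<Lambda>\<close> makes the two notions agree as predicates of
    \<open>\<Lambda>\<close>, which settles existence in both directions.\<close>
  have "weakly_tendsto M (\<lambda>r. SAMV M r u) \<Lambda> \<longleftrightarrow> weakly_tendsto M (\<lambda>r. AMV M r u) \<Lambda>" for \<Lambda>
    unfolding weakly_tendsto_def using Lim_transform_eq[OF diff] by blast
  then have iff: "has_weak_SAMV_Laplacian M u \<Lambda> \<longleftrightarrow> has_weak_AMV_Laplacian M u \<Lambda>" for \<Lambda>
    by (simp add: has_weak_SAMV_Laplacian_def has_weak_AMV_Laplacian_def)
  have "\<Lambda> = \<Lambda>'" if "has_weak_AMV_Laplacian M u \<Lambda>" "has_weak_AMV_Laplacian M u \<Lambda>'" for \<Lambda> \<Lambda>'
  \<comment> \<open>On \<open>Cc\<close> limits are unique; outside \<open>Cc\<close> both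
    functionals take the default value of extensional functions.\<close>
  proof (rule extensionalityI)
    show "\<Lambda> \<in> extensional Cc" "\<Lambda>' \<in> extensional Cc"
      using that by (auto simp: has_weak_AMV_Laplacian_def signed_Radon_def)
    show "\<Lambda> \<phi> = \<Lambda>' \<phi>" if "\<phi> \<in> Cc" for \<phi>
      using \<open>has_weak_AMV_Laplacian M u \<Lambda>\<close> \<open>has_weak_AMV_Laplacian M u \<Lambda>'\<close> that
      by (auto simp: has_weak_AMV_Laplacian_def weakly_tendsto_def
          intro: tendsto_unique[OF trivial_limit_at_right_real])
  qed
  with iff show ?thesis by blast
qed

end
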